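(* Let $R$ and $\mu$ be as in the context. If $R(k,0)=0$ for all $k\in\mathbb Z$ with $k\neq0$, then $\mu=\mu_s$, where $\mu_s$ is the Wigner semicircle law $\mu_s(dx)=\frac{\sqrt{4-x^2}}{2\pi}\mathbf 1(|x|\le2)\,dx$.
   Context: Let $(Y_{i,j}:i,j\in\mathbb Z)$ be a weakly stationary real process with $E(Y_{i,j})=0$, $E(Y_{i,j}^2)=1$ and $E(Y_{i,j}Y_{i-u,j+v})=R(u,v)$ for all $i,j,u,v\in\mathbb Z$. Assume $R(u,v)=R(v,u)$ for all $u,v\in\mathbb Z$ and $\sum_{u,v\in\mathbb Z}|R(u,v)|<\infty$. For $m\ge1$, $NC_2(2m)$ is the set of non-crossing pair partitions of $\{1,\dots,2m\}$. For $\sigma\in NC_2(2m)$, its Kreweras complement is the maximal (coarsest) partition $\overline\sigma$ of $\{\overline1,\dots,\overline{2m}\}$ such that $\sigma\cup\overline\sigma$ is a non-crossing partition of the ordered set $1<\overline1<2<\overline2<\dots<2m<\overline{2m}$. It has $m+1$ blocks $V_1,\dots,V_{m+1}$, regarded (dropping bars) as subsets of $\{1,\dots,2m\}$. Define $S(\sigma):=\{k\in\mathbb Z^{2m}:\sum_{j\in V_s}k_j=0,\ s=1,\dots,m+1\}$ and $\beta_{2m}:=\sum_{\sigma\in NC_2(2m)}\sum_{k\in S(\sigma)}\prod_{(u,v)\in\sigma}R(k_u,k_v)$ for $m\ge1$ (absolutely convergent). Let $\mu$ be the unique even probability measure on $\mathbb R$ whose $2m$-th moment equals $\beta_{2m}$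 for all $m\ge1$ (such a $\mu$ exists and is unique). *)

theory Defs
  imports "HOL-Probability.Probability"
begin

locale stationary_field = prob_space M
  for M :: "'a measure" and Y :: "int \<Rightarrow> int \<Rightarrow> 'a \<Rightarrow> real" and R :: "int \<Rightarrow> int \<Rightarrow> real" +
  assumes random_variable: "random_variable borel (Y i j)"
    and square_integrable: "integrable M (\<lambda>\<omega>. (Y i j \<omega>)\<^sup>2)"
    and mean_zero: "expectation (Y i j) = 0"
    and unit_variance: "expectation (\<lambda>\<omega>. (Y i j \<omega>)\<^sup>2) = 1"
    and covariance: "expectation (\<lambda>\<omega>. Y i j \<omega> * Y (i - u) (j + v) \<omega>) = R u v"

definition noncrossing :: "'a::linorder set set \<Rightarrow> bool" where
  "noncrossing P \<longleftrightarrow>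
     \<not> (\<exists>B\<in>P. \<exists>C\<in>P. B \<noteq> C \<and> (\<exists>a\<in>B. \<exists>b\<in>C. \<exists>c\<in>B. \<exists>d\<in>C. a < b \<and> b < c \<and> c < d))"

definition NC2 :: "nat \<Rightarrow> nat set set set" where
  "NC2 n = {\<sigma>. partition_on {1..n} \<sigma> \<and> (\<forall>B\<in>\<sigma>. card B = 2) \<and> noncrossing \<sigma>}"

text \<open>
  The union of a partition of \<open>1, \<dots>, n\<close> with a partition of the barred copy of
  \<open>1, \<dots>, n\<close>. The point \<open>j\<close> is encoded as \<open>2 * j\<close> and its barred copy as \<open>2 * j + 1\<close>, so the
  order on \<open>nat\<close> is the interlaced order in which each barred point directly follows its
  unbarred one.
\<close>
definition interlace :: "nat set set \<Rightarrow> nat set set \<Rightarrow> nat set set" where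
  "interlace \<sigma> \<tau> = ((`) (\<lambda>j. 2 * j)) ` \<sigma> \<union> ((`) (\<lambda>j. 2 * j + 1)) ` \<tau>"

definition kreweras :: "nat \<Rightarrow> nat set set \<Rightarrow> nat set set" where
  "kreweras n \<sigma> = (THE K. partition_on {1..n} K \<and> noncrossing (interlace \<sigma> K) \<and>
     (\<forall>\<tau>. partition_on {1..n} \<tau> \<and> noncrossing (interlace \<sigma> \<tau>) \<longrightarrow> refines {1..n} \<tau> K))"

definition S :: "nat \<Rightarrow> nat set set \<Rightarrow> (nat \<Rightarrow> int) set" where
  "S n \<sigma> = {k \<in> {1..n} \<rightarrow>\<^sub>E UNIV. \<forall>V\<in>kreweras n \<sigma>. (\<Sum>j\<in>V. k j) = 0}"

text \<open>
  Each block \<open>B\<close> of a pair partition is the pair \<open>(Min B, Max B)\<close>; the order of the two points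
  is irrelevant for symmetric \<open>R\<close>.
\<close>
definition beta :: "(int \<Rightarrow> int \<Rightarrow> real) \<Rightarrow> nat \<Rightarrow> real" where
  "beta R n = (\<Sum>\<sigma>\<in>NC2 n. \<Sum>\<^sub>\<infinity>k\<in>S n \<sigma>. \<Prod>B\<in>\<sigma>. R (k (Min B)) (k (Max B)))"

definition limit_law :: "(int \<Rightarrow> int \<Rightarrow> real) \<Rightarrow> real measure \<Rightarrow> bool" where
  "limit_law R \<mu> \<longleftrightarrow>
     real_distribution \<mu> \<and> distr \<mu> borel uminus = \<mu> \<and>
     (\<forall>m\<ge>1. has_bochner_integral \<mu> (\<lambda>x. x ^ (2 * m)) (beta R (2 * m)))"

definition semicircle :: "real measure" where
  "semicircle =
     density lborel (\<lambda>x. ennreal (sqrt (4 - x\<^sup>2) / (2 * pi) * indicator {x. \<bar>x\<bar> \<le> 2} x))"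

end

theory Submission
  imports Defs
begin

text \<open>
  Under the assumption on \<open>R\<close> only \<open>k = 0\<close> contributes to the sum over \<open>S(\<sigma>)\<close>. Indeed, let
  \<open>{u < v}\<close> be a pair of \<open>\<sigma>\<close>. The block of the Kreweras complement containing \<open>u\<close> lies in
  \<open>{u, \<dots>, v - 1}\<close>, and the points strictly between \<open>u\<close> and \<open>v\<close> are paired among themselves, so by
  induction on \<open>v - u\<close> the block condition reads \<open>k\<^sub>u = 0\<close>, and a nonzero factor \<open>R(0, k\<^sub>v)\<close> forces
  \<open>k\<^sub>v = 0\<close>. Hence \<open>\<beta>\<^sub>2\<^sub>m\<close> is the number of non-crossing pairings. These counts and the semicircle
  moments obey the same two-term recurrence, and since the moments grow only geometrically, the
  Taylor expansion of the characteristic function identifies the law.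
\<close>

section \<open>Counting non-crossing pairings\<close>

lemma noncrossingD:
  assumes "noncrossing P" "B \<in> P" "C \<in> P" "a \<in> B" "b \<in> C" "c \<in> B" "d \<in> C" "a < b" "b < c" "c < d"
  shows "B = C"
  using assms unfolding noncrossing_def by blast

text \<open>The ground set is arbitrary because the recursion passes to intervals that do not start
  at 1.\<close>

definition pairings :: "'a::linorder set \<Rightarrow> 'a set set set" where
  "pairings A = {\<sigma>. partition_on A \<sigma> \<and> (\<forall>B\<in>\<sigma>. card B = 2) \<and> noncrossing \<sigma>}"

lemma NC2_eq: "NC2 n = pairings {1..n}"
  by (simp add: NC2_def pairings_def)

lemma finite_pairings: "finite A \<Longrightarrow> finite (pairings A)"
  by (rule finite_subset[of _ "Pow (Pow A)"]) (auto simp: pairings_def partition_on_def)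

lemma pairings_empty: "pairings {} = {{}}"
  by (auto simp: pairings_def partition_on_def noncrossing_def)

lemma pairings_partner:
  assumes "\<sigma> \<in> pairings A" "x \<in> A"
  obtains y where "y \<in> A" "y \<noteq> x" "{x, y} \<in> \<sigma>"
proof -
  obtain B where B: "B \<in> \<sigma>" "x \<in> B" using assms by (auto simp: pairings_def partition_on_def)
  then obtain u v where "B = {u, v}" "u \<noteq> v"
    using assms by (auto simp: pairings_def card_2_iff)
  with B have "\<exists>y. y \<noteq> x \<and> B = {x, y}" by auto
  with B assms that show thesis by (auto simp: pairings_def partition_on_def)
qed

lemma pairings_block_unique:
  assumes "\<sigma> \<in> pairings A" "B \<in> \<sigma>" "C \<in> \<sigma>" "x \<in> B" "x \<in> C"
  shows "B = C"
  using assms by (auto simp: pairings_def partition_on_def disjoint_def)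

text \<open>Blocks of \<open>\<sigma>\<close> lie strictly under the arc from \<open>a\<close> to
  \<open>j\<close> and blocks of \<open>\<tau>\<close> strictly to its right, so blocks from
  different groups never interleave. Within one group a crossing is excluded by hypothesis.\<close>

lemma insert_pairing:
  fixes a b j :: nat
  assumes \<sigma>: "\<sigma> \<in> pairings {a<..<j}" and \<tau>: "\<tau> \<in> pairings {j<..<b}" and j: "j \<in> {a<..<b}"
  shows "insert {a, j} (\<sigma> \<union> \<tau>) \<in> pairings {a..<b}"
proof -
  have sub: "\<And>B. B \<in> \<sigma> \<Longrightarrow> B \<subseteq> {a<..<j}" "\<And>B. B \<in> \<tau> \<Longrightarrow> B \<subseteq> {j<..<b}"
    using \<sigma> \<tau> by (auto simp: pairings_def partition_on_def)
  have d: "disjoint \<sigma>" "disjoint \<tau>" "{} \<notin> \<sigma>" "{} \<notin> \<tau>" "\<Union>\<sigma> = {a<..<j}" "\<Union>\<tau> = {j<..<b}"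
    using \<sigma> \<tau> by (auto simp: pairings_def partition_on_def)
  have "disjoint ({{a, j}} \<union> (\<sigma> \<union> \<tau>))"
  proof (intro disjoint_union d)
    show "\<Union>\<sigma> \<inter> \<Union>\<tau> = {}" unfolding d by auto
    show "\<Union>{{a, j}} \<inter> \<Union>(\<sigma> \<union> \<tau>) = {}" unfolding Union_Un_distrib d using j by auto
  qed simp
  then have "disjoint (insert {a, j} (\<sigma> \<union> \<tau>))" by simp
  moreover have "\<Union>(insert {a, j} (\<sigma> \<union> \<tau>)) = {a..<b}"
    unfolding Union_insert Union_Un_distrib d using j by auto
  ultimately have p: "partition_on {a..<b} (insert {a, j} (\<sigma> \<union> \<tau>))"
    using d(3,4) unfolding partition_on_def by blast
  have nc: "noncrossing (insert {a, j} (\<sigma> \<union> \<tau>))"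
    unfolding noncrossing_def
  proof (rule notI, elim bexE conjE)
    fix B C w x y z
    assume BC: "B \<in> insert {a, j} (\<sigma> \<union> \<tau>)" "C \<in> insert {a, j} (\<sigma> \<union> \<tau>)" "B \<noteq> C"
      and el: "w \<in> B" "x \<in> C" "y \<in> B" "z \<in> C" "w < x" "x < y" "y < z"
    have bd\<sigma>: "a < e \<and> e < j" if "X \<in> \<sigma>" "e \<in> X" for X e
      using sub(1)[OF that(1)] that(2) by auto
    have bd\<tau>: "j < e \<and> e < b" if "X \<in> \<tau>" "e \<in> X" for X e
      using sub(2)[OF that(1)] that(2) by auto
    have "B = {a, j} \<or> B \<in> \<sigma> \<or> B \<in> \<tau>" "C = {a, j} \<or> C \<in> \<sigma> \<or> C \<in> \<tau>" using BC(1,2) by simp_all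
    then consider "B = {a, j}" "C \<in> \<sigma>" | "B = {a, j}" "C \<in> \<tau>" | "C = {a, j}" "B \<in> \<sigma>" | "C = {a, j}" "B \<in> \<tau>"
      | "B \<in> \<sigma>" "C \<in> \<tau>" | "B \<in> \<tau>" "C \<in> \<sigma>" | "B \<in> \<sigma>" "C \<in> \<sigma>" | "B \<in> \<tau>" "C \<in> \<tau>"
      using BC(3) by metis
    then show False
    proof cases
      case 1
      then show ?thesis using bd\<sigma>[of C z] el j by auto
    next
      case 2
      then show ?thesis using bd\<tau>[of C x] el j by auto
    next
      case 3
      then show ?thesis using bd\<sigma>[of B w] bd\<sigma>[of B y] el j by auto
    next
      case 4
      then show ?thesis using bd\<tau>[of B w] el j by auto
    next
      case 5
      then show ?thesis using bd\<tau>[of C x] bd\<sigma>[of B y] el by auto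
    next
      case 6
      then show ?thesis using bd\<tau>[of B w] bd\<sigma>[of C x] el by auto
    next
      case 7
      then show ?thesis using noncrossingD[of \<sigma> B C w x y z] BC(3) el \<sigma> by (simp add: pairings_def)
    next
      case 8
      then show ?thesis using noncrossingD[of \<tau> B C w x y z] BC(3) el \<tau> by (simp add: pairings_def)
    qed
  qed
  have "card {a, j} = 2" using j by auto
  with p nc show ?thesis
    using \<sigma> \<tau> by (auto simp: pairings_def)
qed

text \<open>As \<open>a\<close> is the least point, a block with points on both sides of
  \<open>j\<close> would cross the arc \<open>{a, j}\<close>; every other block therefore lies
  wholly on one side.\<close>

lemma pairing_decompose:
  fixes a b j :: nat
  assumes \<sigma>: "\<sigma> \<in> pairings {a..<b}" and aj: "{a, j} \<in> \<sigma>" "j \<noteq> a"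
  shows "{B \<in> \<sigma>. B \<subseteq> {a<..<j}} \<in> pairings {a<..<j}"
    and "{B \<in> \<sigma>. B \<subseteq> {j<..<b}} \<in> pairings {j<..<b}"
    and "\<sigma> = insert {a, j} ({B \<in> \<sigma>. B \<subseteq> {a<..<j}} \<union> {B \<in> \<sigma>. B \<subseteq> {j<..<b}})"
proof -
  have part: "partition_on {a..<b} \<sigma>" and nc: "noncrossing \<sigma>"
    using \<sigma> by (auto simp: pairings_def)
  have "j \<in> {a..<b}" using part aj(1) by (auto simp: partition_on_def)
  then have j: "a < j" "j < b" using aj(2) by auto
  have cases: "B \<subseteq> {a<..<j} \<or> B \<subseteq> {j<..<b}" if B: "B \<in> \<sigma>" "B \<noteq> {a, j}" for B
  proof (rule ccontr)
    assume H: "\<not> ?thesis"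
    have "a \<notin> B" "j \<notin> B" using pairings_block_unique[OF \<sigma> aj(1) B(1)] B(2) by auto
    moreover have "B \<subseteq> {a..<b}" using part B by (auto simp: partition_on_def)
    ultimately have bounds: "a < x \<and> x < b \<and> x \<noteq> j" if "x \<in> B" for x
      using that by (metis atLeastLessThan_iff le_neq_implies_less subset_iff)
    obtain x where x: "x \<in> B" "x \<notin> {j<..<b}" using H by blast
    obtain y where y: "y \<in> B" "y \<notin> {a<..<j}" using H by blast
    \<comment> \<open>Then \<open>a < x < j < y\<close> alternates between \<open>{a, j}\<close> and
      \<open>B\<close>, a crossing.\<close>
    have "a < x" "x < j" "j < y" using bounds[OF x(1)] bounds[OF y(1)] x y by auto
    then show False using noncrossingD[OF nc aj(1) B(1) _ x(1) _ y(1), of a j] B(2) by auto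
  qed
  have restrict: "{B \<in> \<sigma>. B \<subseteq> I} \<in> pairings I"
    if I: "I = {a<..<j} \<or> I = {j<..<b}" for I
  proof -
    have "x \<in> \<Union>{B \<in> \<sigma>. B \<subseteq> I}" if x: "x \<in> I" for x
    proof -
      have "x \<in> {a..<b}" "x \<noteq> a" "x \<noteq> j" using I x j by auto
      then obtain B where B: "B \<in> \<sigma>" "x \<in> B"
        using partition_onD1[OF part] by blast
      then have "B \<noteq> {a, j}" using \<open>x \<noteq> a\<close> \<open>x \<noteq> j\<close> by blast
      then have "B \<subseteq> {a<..<j} \<or> B \<subseteq> {j<..<b}" using cases B(1) by blast
      moreover have "\<not> (x \<in> {a<..<j} \<and> x \<in> {j<..<b})" by auto
      ultimately have "B \<subseteq> I" using I x B(2) by blast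
      then show ?thesis using B by blast
    qed
    then have "\<Union>{B \<in> \<sigma>. B \<subseteq> I} = I" by auto
    moreover have "noncrossing {B \<in> \<sigma>. B \<subseteq> I}" using nc unfolding noncrossing_def by simp
    moreover have "disjoint {B \<in> \<sigma>. B \<subseteq> I}" "{} \<notin> {B \<in> \<sigma>. B \<subseteq> I}"
      using part by (auto simp: partition_on_def pairwise_def)
    ultimately show ?thesis using \<sigma> unfolding pairings_def partition_on_def by blast
  qed
  show "{B \<in> \<sigma>. B \<subseteq> {a<..<j}} \<in> pairings {a<..<j}" "{B \<in> \<sigma>. B \<subseteq> {j<..<b}} \<in> pairings {j<..<b}"
    by (rule restrict; simp)+
  show "\<sigma> = insert {a, j} ({B \<in> \<sigma>. B \<subseteq> {a<..<j}} \<union> {B \<in> \<sigma>. B \<subseteq> {j<..<b}})"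
    using cases aj(1) by blast
qed

text \<open>Pairings are classified by the partner \<open>j\<close> of the least point; for fixed
  \<open>j\<close> they correspond to pairs of pairings of the two remaining intervals.\<close>

lemma card_pairings_rec:
  fixes a b :: nat
  assumes "a < b"
  shows "card (pairings {a..<b}) =
    (\<Sum>j\<in>{a<..<b}. card (pairings {a<..<j}) * card (pairings {j<..<b}))"
proof -
  define F where "F j = (\<lambda>(\<sigma>, \<tau>). insert {a, j} (\<sigma> \<union> \<tau>))" for j :: nat
  define D where "D j = pairings {a<..<j} \<times> pairings {j<..<b}" for j
  have eq: "pairings {a..<b} = (\<Union>j\<in>{a<..<b}. F j ` D j)"
  proof (intro equalityI subsetI)
    fix \<sigma> assume s: "\<sigma> \<in> pairings {a..<b}"
    obtain j where j: "j \<in> {a..<b}" "j \<noteq> a" "{a, j} \<in> \<sigma>"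
      by (rule pairings_partner[OF s, of a]) (use assms in auto)
    have "\<sigma> = F j ({B \<in> \<sigma>. B \<subseteq> {a<..<j}}, {B \<in> \<sigma>. B \<subseteq> {j<..<b}})"
      unfolding F_def using pairing_decompose(3)[OF s j(3,2)] by simp
    moreover have "({B \<in> \<sigma>. B \<subseteq> {a<..<j}}, {B \<in> \<sigma>. B \<subseteq> {j<..<b}}) \<in> D j"
      unfolding D_def using pairing_decompose(1,2)[OF s j(3,2)] by simp
    ultimately show "\<sigma> \<in> (\<Union>j\<in>{a<..<b}. F j ` D j)" using j by fastforce
  next
    fix \<sigma> assume "\<sigma> \<in> (\<Union>j\<in>{a<..<b}. F j ` D j)"
    then show "\<sigma> \<in> pairings {a..<b}" by (auto simp: F_def D_def intro!: insert_pairing)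
  qed
  have inj: "inj_on (F j) (D j)" if j: "j \<in> {a<..<b}" for j
  proof (rule inj_on_inverseI)
    fix p assume p: "p \<in> D j"
    obtain \<sigma> \<tau> where [simp]: "p = (\<sigma>, \<tau>)" by (cases p)
    have "\<And>B. B \<in> \<sigma> \<Longrightarrow> B \<subseteq> {a<..<j} \<and> B \<noteq> {}" "\<And>B. B \<in> \<tau> \<Longrightarrow> B \<subseteq> {j<..<b} \<and> B \<noteq> {}"
      using p by (auto simp: D_def pairings_def partition_on_def)
    \<comment> \<open>Nonemptiness matters here: an empty block would lie in both intervals, and
      filtering could not recover the two halves.\<close>
    moreover from this have "\<And>B. B \<in> \<sigma> \<Longrightarrow> \<not> B \<subseteq> {j<..<b}" "\<And>B. B \<in> \<tau> \<Longrightarrow> \<not> B \<subseteq> {a<..<j}"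
      by (meson disjoint_iff greaterThanLessThan_iff less_asym subset_eq ex_in_conv)+
    ultimately show "({B \<in> F j p. B \<subseteq> {a<..<j}}, {B \<in> F j p. B \<subseteq> {j<..<b}}) = p"
      using j by (auto simp: F_def)
  qed
  have disj: "F i ` D i \<inter> F j ` D j = {}" if "i \<in> {a<..<b}" "j \<in> {a<..<b}" "i \<noteq> j" for i j
  proof -
    have False if "\<sigma> \<in> F i ` D i" "\<sigma> \<in> F j ` D j" for \<sigma>
    proof -
      have "\<sigma> \<in> pairings {a..<b}" using eq that \<open>i \<in> _\<close> by blast
      moreover have "{a, k} \<in> \<sigma>" if "\<sigma> \<in> F k ` D k" for k
        using that by (auto simp: F_def)
      then have "{a, i} \<in> \<sigma>" "{a, j} \<in> \<sigma>" using that by auto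
      ultimately have "{a, i} = {a, j}" using pairings_block_unique by blast
      then show False using \<open>i \<noteq> j\<close> by (auto simp: doubleton_eq_iff)
    qed
    then show ?thesis by blast
  qed
  have "card (pairings {a..<b}) = (\<Sum>j\<in>{a<..<b}. card (F j ` D j))"
    unfolding eq by (rule card_UN_disjoint) (use disj in \<open>auto simp: D_def intro!: finite_pairings\<close>)
  also have "\<dots> = (\<Sum>j\<in>{a<..<b}. card (D j))"
    by (intro sum.cong refl card_image inj)
  finally show ?thesis by (simp add: D_def card_cartesian_product)
qed

text \<open>Substitutes \<open>j = a + 1 + i\<close> and writes both intervals as start plus length,
  the form needed for an induction on the length.\<close>

lemma card_pairings_Suc:
  fixes a n :: nat
  shows "card (pairings {a..<a + Suc n}) =
    (\<Sum>i<n. card (pairings {Suc a..<Suc a + i}) * card (pairings {a + i + 2..<a + i + 2 + (n - Suc i)}))"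
proof -
  have "card (pairings {a..<a + Suc n}) = (\<Sum>j\<in>{a<..<a + Suc n}.
      card (pairings {a<..<j}) * card (pairings {j<..<a + Suc n}))"
    by (rule card_pairings_rec) simp
  also have "\<dots> = (\<Sum>i<n. card (pairings {Suc a..<Suc a + i})
      * card (pairings {a + i + 2..<a + i + 2 + (n - Suc i)}))"
    by (rule sum.reindex_bij_witness[of _ "\<lambda>i. Suc a + i" "\<lambda>j. j - Suc a"])
      (auto simp: atLeastSucLessThan_greaterThanLessThan[symmetric] add.commute intro!: arg_cong2[of _ _ _ _ "(*)"])
  finally show ?thesis .
qed

text \<open>The recurrence expresses the count through strictly shorter intervals, with lengths that
  do not involve the starting point.\<close>

lemma card_pairings_shift: "card (pairings {a..<a + n}) = card (pairings {0..<n})" for a n :: nat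
proof (induction n arbitrary: a rule: less_induct)
  case (less n)
  show ?case
  proof (cases n)
    case (Suc m)
    have "card (pairings {b..<b + Suc m}) =
      (\<Sum>i<m. card (pairings {0..<i}) * card (pairings {0..<m - Suc i}))" for b
      unfolding card_pairings_Suc using Suc
      by (intro sum.cong refl arg_cong2[of _ _ _ _ "(*)"] less) auto
    from this[of a] this[of 0] show ?thesis using Suc by simp
  qed (simp add: pairings_empty)
qed

text \<open>These are the Catalan numbers interspersed with zeros: zero for odd \<open>n\<close>,
  the Catalan number of index \<open>n / 2\<close> for even \<open>n\<close>.\<close>

definition pairing_count :: "nat \<Rightarrow> nat" where
  "pairing_count n = card (pairings {0..<n})"

lemma card_NC2: "card (NC2 n) = pairing_count n"
  using card_pairings_shift[of 1 n] by (simp add: NC2_eq pairing_count_def atLeastLessThanSuc_atLeastAtMost)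

lemma pairing_count_0: "pairing_count 0 = 1"
  by (simp add: pairing_count_def pairings_empty)

lemma pairing_count_Suc: "pairing_count (Suc n) = (\<Sum>i<n. pairing_count i * pairing_count (n - Suc i))"
  using card_pairings_Suc[of 0 n, unfolded card_pairings_shift] by (simp add: pairing_count_def)

text \<open>The generating function satisfies \<open>g = 1 + X\<^sup>2 g\<^sup>2\<close>, hence \<open>X (1 - 4 X\<^sup>2) g' = 2 (1 - g + 2 X\<^sup>2 g)\<close>.\<close>
lemma pairing_count_ratio:
  "real (n + 4) * real (pairing_count (n + 2)) = 4 * real (n + 1) * real (pairing_count n)"
proof -
  define g :: "real fps" where "g = Abs_fps (\<lambda>n. real (pairing_count n))"
  have g: "g = 1 + fps_X ^ 2 * g ^ 2"
  proof (rule fps_ext)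
    fix n show "fps_nth g n = fps_nth (1 + fps_X ^ 2 * g ^ 2) n"
    proof (cases n)
      case (Suc m)
      show ?thesis
      proof (cases m)
        case 0
        then show ?thesis using Suc pairing_count_Suc[of 0] by (simp add: g_def fps_X_power_mult_nth)
      next
        case (Suc l)
        have "pairing_count n = (\<Sum>i\<le>l. pairing_count i * pairing_count (l - i))"
          using pairing_count_Suc[of m] Suc \<open>n = Suc m\<close> by (simp add: lessThan_Suc_atMost)
        moreover have "fps_nth (g ^ 2) l = (\<Sum>i\<le>l. real (pairing_count i * pairing_count (l - i)))"
          by (simp add: g_def power2_eq_square fps_mult_nth atLeast0AtMost)
        ultimately show ?thesis using Suc \<open>n = Suc m\<close>
          by (simp add: fps_X_power_mult_nth) (simp add: g_def)
      qed
    qed (simp add: g_def pairing_count_0)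
  qed
  define h where "h = fps_deriv g"
  define X :: "real fps" where "X = fps_X"
  have gX: "X\<^sup>2 * g\<^sup>2 = g - 1" using g unfolding X_def by (simp add: algebra_simps)
  have "h = fps_deriv (1 + X ^ 2 * g ^ 2)" using g unfolding X_def h_def by simp
  then have h: "h = 2 * X * g\<^sup>2 + 2 * X\<^sup>2 * g * h"
    unfolding X_def h_def by (simp add: fps_deriv_power power2_eq_square algebra_simps)
  \<comment> \<open>By \<open>gX\<close>,
    \<open>(1 - 2 * X\<^sup>2 * g)\<^sup>2 = 1 - 4 * X\<^sup>2\<close>. The claim follows on
    multiplying \<open>h * (1 - 2 * X\<^sup>2 * g) = 2 * X * g\<^sup>2\<close> by
    \<open>X * (1 - 2 * X\<^sup>2 * g)\<close> and applying \<open>gX\<close> again.\<close>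
  have "X * (1 - 4 * X\<^sup>2) * h = 2 * (1 - g + 2 * X\<^sup>2 * g)"
    using gX h by algebra
  then have "X * h + 2 * g = 2 + 4 * (X\<^sup>2 * g) + 4 * (X^2 * (X * h))"
    by (simp add: algebra_simps power2_eq_square)
  \<comment> \<open>Passing from \<open>g\<close> to \<open>X * h\<close> multiplies the k-th
    coefficient by k, so the two sides give the factors \<open>(n + 2) + 2\<close> and
    \<open>4 + 4 * n\<close>.\<close>
  then have "fps_nth (X * h + 2 * g) (n + 2) = fps_nth (2 + 4 * (X\<^sup>2 * g) + 4 * (X\<^sup>2 * (X * h))) (n + 2)"
    by simp
  then show ?thesis
    by (cases n; simp add: X_def h_def g_def fps_X_power_mult_nth numeral_fps_const; simp add: algebra_simps)
qed

section \<open>The Kreweras complement\<close>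

text \<open>A chord from \<open>a\<close> to \<open>b\<close> of \<open>\<sigma>\<close> separates the barred points of \<open>i\<close> and \<open>j\<close>; the Kreweras complement
  consists of the classes of points that no chord separates.\<close>
definition crossed :: "nat set set \<Rightarrow> nat \<Rightarrow> nat \<Rightarrow> bool" where
  "crossed \<sigma> i j \<longleftrightarrow> (\<exists>B\<in>\<sigma>. \<exists>a\<in>B. \<exists>b\<in>B. (i \<in> {a..<b}) \<noteq> (j \<in> {a..<b}))"

lemma crossed_sym: "crossed \<sigma> i j \<Longrightarrow> crossed \<sigma> j i"
  unfolding crossed_def by blast

text \<open>In contrapositive form: lying on the same side of every chord is transitive, as needed
  to form classes.\<close>

lemma crossed_trans: "crossed \<sigma> i k \<Longrightarrow> crossed \<sigma> i j \<or> crossed \<sigma> j k"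
  unfolding crossed_def by blast

text \<open>The barred copy of \<open>i\<close> directly follows \<open>i\<close>, so it lies
  between \<open>a\<close> and \<open>b\<close> exactly when \<open>a \<le> i < b\<close>; hence the
  half-open intervals in \<open>crossed\<close>. A chord separating two barred points of
  \<open>V\<close> interleaves with them.\<close>

lemma noncrossing_interlace_not_crossed:
  assumes nc: "noncrossing (interlace \<sigma> \<tau>)" and V: "V \<in> \<tau>" "i \<in> V" "j \<in> V"
  shows "\<not> crossed \<sigma> i j"
proof
  have *: False if "B \<in> \<sigma>" "a \<in> B" "b \<in> B" "i \<in> V" "j \<in> V" "a \<le> i" "i < b" "\<not> (a \<le> j \<and> j < b)" for B a b i j
  proof -
    let ?B = "(\<lambda>j. 2 * j) ` B" and ?V = "(\<lambda>j. 2 * j + 1) ` V"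
    have mem: "?B \<in> interlace \<sigma> \<tau>" "?V \<in> interlace \<sigma> \<tau>"
      using that(1) V(1) by (auto simp: interlace_def)
    have el: "2 * a \<in> ?B" "2 * b \<in> ?B" "2 * i + 1 \<in> ?V" "2 * j + 1 \<in> ?V" using that by auto
    have "?B \<noteq> ?V"
    proof
      assume "?B = ?V"
      then obtain x where "2 * a = 2 * x + 1" using el(1) by auto
      then show False by presburger
    qed
    \<comment> \<open>The point \<open>j\<close> outside the chord is either to the right of
      \<open>b\<close> or to the left of \<open>a\<close>; both positions give an alternating
      quadruple.\<close>
    moreover have "2 * a < 2 * i + 1 \<and> 2 * i + 1 < 2 * b \<and> 2 * b < 2 * j + 1 \<or>
      2 * j + 1 < 2 * a \<and> 2 * a < 2 * i + 1 \<and> 2 * i + 1 < 2 * b" using that by auto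
    ultimately show False using nc mem el unfolding noncrossing_def by metis
  qed
  assume "crossed \<sigma> i j"
  then obtain B a b where "B \<in> \<sigma>" "a \<in> B" "b \<in> B" "(i \<in> {a..<b}) \<noteq> (j \<in> {a..<b})"
    unfolding crossed_def by blast
  then show False using *[of B a b i j] *[of B a b j i] V by auto
qed

text \<open>A crossing of two chords contradicts \<open>nc\<close>, one of a chord with a barred
  block contradicts \<open>nx\<close>, and one of two barred blocks contradicts \<open>sep\<close>
  together with \<open>nx\<close>.\<close>

lemma noncrossing_interlaceI:
  assumes nc: "noncrossing \<sigma>"
    and nx: "\<And>V i j. V \<in> \<tau> \<Longrightarrow> i \<in> V \<Longrightarrow> j \<in> V \<Longrightarrow> \<not> crossed \<sigma> i j"
    and sep: "\<And>V W i j. V \<in> \<tau> \<Longrightarrow> W \<in> \<tau> \<Longrightarrow> V \<noteq> W \<Longrightarrow> i \<in> V \<Longrightarrow> j \<in> W \<Longrightarrow> crossed \<sigma> i j"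
  shows "noncrossing (interlace \<sigma> \<tau>)"
  unfolding noncrossing_def
proof (rule notI, elim bexE conjE)
  fix B C w x y z
  assume BC: "B \<in> interlace \<sigma> \<tau>" "C \<in> interlace \<sigma> \<tau>" "B \<noteq> C"
    and el: "w \<in> B" "x \<in> C" "y \<in> B" "z \<in> C" "w < x" "x < y" "y < z"
  consider (pp) B' C' where "B' \<in> \<sigma>" "C' \<in> \<sigma>" "B = (\<lambda>j. 2 * j) ` B'" "C = (\<lambda>j. 2 * j) ` C'"
    | (pk) B' V where "B' \<in> \<sigma>" "V \<in> \<tau>" "B = (\<lambda>j. 2 * j) ` B'" "C = (\<lambda>j. 2 * j + 1) ` V"
    | (kp) V B' where "V \<in> \<tau>" "B' \<in> \<sigma>" "B = (\<lambda>j. 2 * j + 1) ` V" "C = (\<lambda>j. 2 * j) ` B'"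
    | (kk) V W where "V \<in> \<tau>" "W \<in> \<tau>" "B = (\<lambda>j. 2 * j + 1) ` V" "C = (\<lambda>j. 2 * j + 1) ` W"
    using BC(1,2) unfolding interlace_def by blast
  then show False
  proof cases
    case pp
    then obtain a b c d where "w = 2 * a" "x = 2 * b" "y = 2 * c" "z = 2 * d"
      "a \<in> B'" "b \<in> C'" "c \<in> B'" "d \<in> C'" using el by blast
    moreover have "B' \<noteq> C'" using pp BC by auto
    moreover have "a < b" "b < c" "c < d" using calculation el(5-) by auto
    ultimately show False using nc pp(1,2) unfolding noncrossing_def by blast
  next
    case pk
    then obtain a b c d where "w = 2 * a" "x = 2 * b + 1" "y = 2 * c" "z = 2 * d + 1"
      and m: "a \<in> B'" "b \<in> V" "c \<in> B'" "d \<in> V" using el by blast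
    then have "(b \<in> {a..<c}) \<noteq> (d \<in> {a..<c})" using el(5-) by auto
    then show False using nx[OF pk(2) m(2,4)] pk(1) m unfolding crossed_def by blast
  next
    case kp
    then obtain a b c d where "w = 2 * a + 1" "x = 2 * b" "y = 2 * c + 1" "z = 2 * d"
      and m: "a \<in> V" "b \<in> B'" "c \<in> V" "d \<in> B'" using el by blast
    then have "(a \<in> {b..<d}) \<noteq> (c \<in> {b..<d})" using el(5-) by auto
    then show False using nx[OF kp(1) m(1,3)] kp(2) m unfolding crossed_def by blast
  next
    case kk
    then obtain a b c d where "w = 2 * a + 1" "x = 2 * b + 1" "y = 2 * c + 1" "z = 2 * d + 1"
      and m: "a \<in> V" "b \<in> W" "c \<in> V" "d \<in> W" using el by blast
    then have lt: "a < b" "b < c" "c < d" using el by auto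
    have "V \<noteq> W" using kk BC by auto
    then obtain B' p q where B': "B' \<in> \<sigma>" "p \<in> B'" "q \<in> B'" "(a \<in> {p..<q}) \<noteq> (b \<in> {p..<q})"
      using sep[OF kk(1,2) _ m(1,2)] unfolding crossed_def by blast
    \<comment> \<open>Neither \<open>V\<close> nor \<open>W\<close> is split by the chord, so the
      interval would contain \<open>a\<close> and \<open>c\<close> but not \<open>b\<close>, or
      \<open>b\<close> and \<open>d\<close> but not \<open>c\<close>. This is impossible for
      \<open>a < b < c < d\<close>.\<close>
    have "a \<in> {p..<q} \<longleftrightarrow> c \<in> {p..<q}" "b \<in> {p..<q} \<longleftrightarrow> d \<in> {p..<q}"
      using nx[OF kk(1) m(1,3)] nx[OF kk(2) m(2,4)] B' unfolding crossed_def by blast+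
    then show False using B'(4) lt by auto
  qed
qed

text \<open>The definite description is justified by a witness: the classes of points that no chord
  separates form the coarsest admissible partition, and antisymmetry of refinement makes it
  unique.\<close>

lemma kreweras:
  assumes nc: "noncrossing \<sigma>"
  shows "partition_on {1..n} (kreweras n \<sigma>)" and "noncrossing (interlace \<sigma> (kreweras n \<sigma>))"
proof -
  let ?P = "\<lambda>K. partition_on {1..n} K \<and> noncrossing (interlace \<sigma> K) \<and>
     (\<forall>\<tau>. partition_on {1..n} \<tau> \<and> noncrossing (interlace \<sigma> \<tau>) \<longrightarrow> refines {1..n} \<tau> K)"
  define r where "r = {(i, j). i \<in> {1..n} \<and> j \<in> {1..n} \<and> \<not> crossed \<sigma> i j}"
  define K where "K = {1..n} // r"
  have "\<not> crossed \<sigma> i i" for i by (auto simp: crossed_def)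
  then have eq: "equiv {1..n} r"
    using crossed_sym crossed_trans
    by (intro equivI refl_onI symI transI) (auto simp: r_def, blast)
  have part: "partition_on {1..n} K"
    unfolding K_def using eq by (rule partition_on_quotient)
  have nc': "noncrossing (interlace \<sigma> K)"
  proof (rule noncrossing_interlaceI[OF nc])
    show "\<not> crossed \<sigma> i j" if "V \<in> K" "i \<in> V" "j \<in> V" for V i j
      using quotient_eq_iff[OF eq, of V V i j] that by (auto simp: K_def r_def)
    show "crossed \<sigma> i j" if "V \<in> K" "W \<in> K" "V \<noteq> W" "i \<in> V" "j \<in> W" for V W i j
    proof -
      have "i \<in> {1..n}" "j \<in> {1..n}" using that part by (auto simp: partition_on_def)
      then show ?thesis using quotient_eq_iff[OF eq, of V W i j] that by (auto simp: K_def r_def)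
    qed
  qed
  \<comment> \<open>No chord separates two points of a block of \<open>\<tau>\<close>, so the block
    lies in the class of any of its points.\<close>
  have ref: "refines {1..n} \<tau> K" if \<tau>: "partition_on {1..n} \<tau>" "noncrossing (interlace \<sigma> \<tau>)" for \<tau>
    unfolding refines_def
  proof (intro conjI \<tau>(1) part ballI)
    fix V assume V: "V \<in> \<tau>"
    then obtain i where i: "i \<in> V" using \<tau>(1) by (metis partition_onD3 ex_in_conv)
    have "V \<subseteq> {1..n}" using \<tau>(1) V by (auto simp: partition_on_def)
    moreover have "\<not> crossed \<sigma> i j" if "j \<in> V" for j
      using noncrossing_interlace_not_crossed[OF \<tau>(2) V i that] .
    ultimately have "V \<subseteq> r `` {i}" using i by (auto simp: r_def)
    moreover have "r `` {i} \<in> K" using i \<open>V \<subseteq> {1..n}\<close> by (auto simp: K_def intro: quotientI)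
    ultimately show "\<exists>W\<in>K. V \<subseteq> W" by blast
  qed
  have "?P (THE K. ?P K)"
    by (rule theI[of ?P K]) (use part nc' ref refines_asym in blast)+
  then show "partition_on {1..n} (kreweras n \<sigma>)" "noncrossing (interlace \<sigma> (kreweras n \<sigma>))"
    unfolding kreweras_def by blast+
qed

section \<open>Moments of the semicircle law\<close>

definition semicircle_density :: "real \<Rightarrow> real" where
  "semicircle_density x = sqrt (4 - x\<^sup>2) / (2 * pi) * indicator {x. \<bar>x\<bar> \<le> 2} x"

lemma measurable_semicircle_density [measurable]: "semicircle_density \<in> borel_measurable borel"
  unfolding semicircle_density_def by measurable

lemma semicircle_density_nonneg: "0 \<le> semicircle_density x"
  \<comment> \<open>Outside the support \<open>sqrt\<close> has a negative argument and a negative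
    value; there the indicator yields 0.\<close>
  using abs_le_square_iff[of x 2] by (auto simp: semicircle_density_def indicator_def)

lemma semicircle_eq: "semicircle = density lborel (\<lambda>x. ennreal (semicircle_density x))"
  by (simp add: semicircle_def semicircle_density_def)

lemma sets_semicircle [simp, measurable_cong]: "sets semicircle = sets borel"
  by (simp add: semicircle_eq)

text \<open>Transfers gauge integrals, as delivered by the fundamental theorem of calculus, to
  Bochner integrals: continuity on the compact support makes the integrand Lebesgue integrable, and
  the two integrals agree.\<close>

lemma has_bochner_integral_semicircleI:
  assumes "continuous_on {-2..2} f" "((\<lambda>x. f x * sqrt (4 - x\<^sup>2)) has_integral c) {-2..2}"
    "f \<in> borel_measurable borel"
  shows "has_bochner_integral semicircle f (c / (2 * pi))"
proof -
  let ?g = "\<lambda>x. f x * sqrt (4 - x\<^sup>2) / (2 * pi)"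
  have "continuous_on {-2..2} ?g" using assms(1) by (intro continuous_intros) auto
  then have int: "set_integrable lborel {-2..2} ?g"
    by (rule borel_integrable_atLeastAtMost')
  have "(?g has_integral c / (2 * pi)) {-2..2}"
    using has_integral_divide[OF assms(2)] by simp
  then have "(LINT x:{-2..2}|lborel. ?g x) = c / (2 * pi)"
    using set_borel_integral_eq_integral(2)[OF int] by (metis integral_unique)
  with int have "has_bochner_integral lborel (\<lambda>x. indicator {-2..2} x *\<^sub>R ?g x) (c / (2 * pi))"
    by (simp add: has_bochner_integral_iff set_integrable_def set_lebesgue_integral_def)
  also have "(\<lambda>x. indicator {-2..2} x *\<^sub>R ?g x) = (\<lambda>x. semicircle_density x *\<^sub>R f x)"
    by (rule ext) (auto simp: semicircle_density_def indicator_def)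
  finally show ?thesis unfolding semicircle_eq
    by (intro has_bochner_integral_density) (use assms(3) in \<open>auto simp: semicircle_density_nonneg\<close>)
qed

text \<open>The area under the half circle of radius 2 is \<open>2 * pi\<close>. The antiderivative
  \<open>?F\<close> is differentiated only inside the interval, since \<open>sqrt\<close> and
  \<open>arcsin\<close> are singular at the end points.\<close>

lemma semicircle_mass: "has_bochner_integral semicircle (\<lambda>x. 1 :: real) 1"
proof -
  let ?F = "\<lambda>x. x * sqrt (4 - x\<^sup>2) / 2 + 2 * arcsin (x / 2)"
  have "((\<lambda>x. sqrt (4 - x\<^sup>2)) has_integral (?F 2 - ?F (-2))) {-2..2}"
  proof (rule fundamental_theorem_of_calculus_interior)
    show "continuous_on {-2..2} ?F" by (intro continuous_intros) auto
    fix x :: real assume x: "x \<in> {-2<..<2}"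
    then have pos: "4 - x\<^sup>2 > 0" using abs_square_less_1[of "x / 2"] by (auto simp: power_divide abs_less_iff)
    define s where "s = sqrt (4 - x\<^sup>2)"
    have s: "s > 0" "s\<^sup>2 = 4 - x\<^sup>2" using pos by (auto simp: s_def)
    have "sqrt (1 - (x / 2)\<^sup>2) = sqrt ((4 - x\<^sup>2) / 4)" by (simp add: power_divide field_simps)
    also have "\<dots> = s / 2" by (simp add: s_def real_sqrt_divide)
    finally have sq: "sqrt (1 - (x / 2)\<^sup>2) = s / 2" .
    have "(?F has_real_derivative
       (x * (inverse s / 2 * (- (2 * x))) + s) / 2 + 2 * (inverse (s / 2) * (1 / 2))) (at x)"
      using x pos s unfolding sq[symmetric]
      by (auto intro!: derivative_eq_intros simp: s_def)
    also have "(x * (inverse s / 2 * (- (2 * x))) + s) / 2 + 2 * (inverse (s / 2) * (1 / 2)) = s"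
      using s by (simp add: field_simps power2_eq_square)
    finally show "(?F has_vector_derivative sqrt (4 - x\<^sup>2)) (at x)"
      by (simp add: s_def has_real_derivative_iff_has_vector_derivative)
  qed simp
  then have "((\<lambda>x. 1 * sqrt (4 - x\<^sup>2)) has_integral 2 * pi) {-2..2}" by simp
  from has_bochner_integral_semicircleI[OF _ this] show ?thesis by simp
qed

lemma real_distribution_semicircle: "real_distribution semicircle"
proof -
  have "emeasure semicircle (space semicircle) = (\<integral>\<^sup>+x. ennreal 1 \<partial>semicircle)" by simp
  also have "\<dots> = 1"
    using has_bochner_integral_iff[THEN iffD1, OF semicircle_mass]
    by (subst nn_integral_eq_integral) auto
  finally show ?thesis by (intro real_distribution.intro prob_spaceI) (simp_all add: real_distribution_axioms_def)
qed

lemma semicircle_integrable_power: "integrable semicircle (\<lambda>x. x ^ n)"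
proof -
  have "(\<lambda>x::real. x ^ n * sqrt (4 - x\<^sup>2)) integrable_on {-2..2}"
    by (intro integrable_continuous_real continuous_intros)
  then show ?thesis
    using has_bochner_integral_semicircleI[of "\<lambda>x. x ^ n"]
    by (auto simp: integrable_on_def has_bochner_integral_iff continuous_on_power)
qed

text \<open>Integrates the derivative of \<open>x ^ (n + 1) * (4 - x\<^sup>2) powr (3 / 2)\<close>, which vanishes at \<open>\<plusminus>2\<close>.\<close>
lemma semicircle_moment_rec:
  "real (n + 4) * (\<integral>x. x ^ (n + 2) \<partial>semicircle) = 4 * real (n + 1) * (\<integral>x. x ^ n \<partial>semicircle)"
proof -
  let ?F = "\<lambda>x::real. x ^ (n + 1) * ((4 - x\<^sup>2) * sqrt (4 - x\<^sup>2))"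
  let ?f = "\<lambda>x::real. 4 * real (n + 1) * x ^ n - real (n + 4) * x ^ (n + 2)"
  have "((\<lambda>x. ?f x * sqrt (4 - x\<^sup>2)) has_integral (?F 2 - ?F (-2))) {-2..2}"
  proof (rule fundamental_theorem_of_calculus_interior)
    show "continuous_on {-2..2} ?F" by (intro continuous_intros)
    fix x :: real assume x: "x \<in> {-2<..<2}"
    then have pos: "4 - x\<^sup>2 > 0" using abs_square_less_1[of "x / 2"] by (auto simp: power_divide abs_less_iff)
    define s where "s = sqrt (4 - x\<^sup>2)"
    have s: "s > 0" "s\<^sup>2 = 4 - x\<^sup>2" using pos by (auto simp: s_def)
    have "((\<lambda>x. x ^ (n + 1)) has_real_derivative real (n + 1) * x ^ n) (at x)"
      using DERIV_pow[of "n + 1" x UNIV] by simp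
    moreover have "((\<lambda>x. (4 - x\<^sup>2) * sqrt (4 - x\<^sup>2)) has_real_derivative
        - (2 * x) * s + (4 - x\<^sup>2) * (inverse s / 2 * (- (2 * x)))) (at x)"
      using pos by (auto intro!: derivative_eq_intros simp: s_def)
    ultimately have "(?F has_real_derivative (real (n + 1) * x ^ n * ((4 - x\<^sup>2) * s)
        + (- (2 * x) * s + (4 - x\<^sup>2) * (inverse s / 2 * (- (2 * x)))) * x ^ (n + 1))) (at x)"
      unfolding s_def by (rule DERIV_mult)
    \<comment> \<open>Writing \<open>4 - x\<^sup>2\<close> as \<open>s\<^sup>2\<close> cancels the
      inverse and leaves a polynomial times \<open>s\<close>.\<close>
    also have "(4 - x\<^sup>2) * (inverse s / 2 * (- (2 * x))) = - s * x"
      using s(1) unfolding s(2)[symmetric] by (simp add: power2_eq_square)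
    also have "real (n + 1) * x ^ n * ((4 - x\<^sup>2) * s) + (- (2 * x) * s + - s * x) * x ^ (n + 1) = ?f x * s"
      by (simp add: algebra_simps power2_eq_square)
    finally show "(?F has_vector_derivative ?f x * sqrt (4 - x\<^sup>2)) (at x)"
      by (simp add: s_def has_real_derivative_iff_has_vector_derivative)
  qed simp
  then have "((\<lambda>x. ?f x * sqrt (4 - x\<^sup>2)) has_integral 0) {-2..2}" by simp
  then have "has_bochner_integral semicircle ?f (0 / (2 * pi))"
    by (intro has_bochner_integral_semicircleI continuous_intros) simp_all
  then have "(\<integral>x. ?f x \<partial>semicircle) = 0" by (simp add: has_bochner_integral_iff)
  then show ?thesis
    using semicircle_integrable_power[of n] semicircle_integrable_power[of "n + 2"]
    by (simp del: power_Suc)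
qed

lemma semicircle_symmetric: "distr semicircle borel uminus = semicircle"
proof -
  have "semicircle_density (- x) = semicircle_density x" for x
    by (simp add: semicircle_density_def indicator_def)
  then have "distr semicircle borel uminus
      = distr (density lborel (\<lambda>x. ennreal (semicircle_density (- x)))) borel uminus"
    by (simp add: semicircle_eq)
  also have "\<dots> = density (distr lborel borel uminus) (\<lambda>x. ennreal (semicircle_density x))"
    by (rule density_distr[symmetric]) auto
  finally show ?thesis by (simp add: lborel_distr_uminus semicircle_eq)
qed

section \<open>Identification of the limit law\<close>

lemma card_2_Min_Max:
  fixes B :: "'a::linorder set"
  assumes "card B = 2"
  shows "x \<in> B \<longleftrightarrow> x = Min B \<or> x = Max B" and "Min B < Max B"
proof -
  obtain a b where "B = {a, b}" "a < b"
    using assms unfolding card_2_iff by (metis insert_commute linorder_neqE)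
  then show "x \<in> B \<longleftrightarrow> x = Min B \<or> x = Max B" "Min B < Max B" by (auto simp: min_def max_def)
qed

lemma zero_of_nonzero_prod:
  fixes R :: "int \<Rightarrow> int \<Rightarrow> real"
  assumes \<sigma>: "\<sigma> \<in> NC2 n" and k: "k \<in> S n \<sigma>"
    and R: "\<And>k. k \<noteq> 0 \<Longrightarrow> R 0 k = 0"
    and nz: "(\<Prod>B\<in>\<sigma>. R (k (Min B)) (k (Max B))) \<noteq> 0"
  shows "B \<in> \<sigma> \<Longrightarrow> k (Min B) = 0 \<and> k (Max B) = 0"
proof (induction "Max B - Min B" arbitrary: B rule: less_induct)
  case less
  let ?u = "Min B" and ?v = "Max B"
  have part: "partition_on {1..n} \<sigma>" and two: "\<And>B. B \<in> \<sigma> \<Longrightarrow> card B = 2" and nc: "noncrossing \<sigma>"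
    using \<sigma> by (auto simp: NC2_def)
  have fin: "finite \<sigma>" using part finite_elements by blast
  have B: "\<And>x. x \<in> B \<longleftrightarrow> x = ?u \<or> x = ?v" "?u < ?v"
    by (rule card_2_Min_Max two less.prems)+
  have uv: "?u \<in> B" "?v \<in> B" by (auto simp: B(1))
  \<comment> \<open>A point strictly under the arc belongs to a block nested under it, since
    otherwise that block would cross \<open>B\<close>; the nested arc is shorter, so the induction
    hypothesis applies.\<close>
  have inner: "k j = 0" if j: "?u < j" "j < ?v" for j
  proof -
    have "?u \<in> {1..n}" "?v \<in> {1..n}" using partition_onD1[OF part] uv less.prems by blast+
    then have "j \<in> {1..n}" using j by auto
    then obtain C where C: "C \<in> \<sigma>" "j \<in> C" using partition_onD1[OF part] by blast
    have C2: "\<And>x. x \<in> C \<longleftrightarrow> x = Min C \<or> x = Max C" "Min C < Max C"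
      by (rule card_2_Min_Max two C)+
    have minC: "Min C \<in> C" and maxC: "Max C \<in> C" by (auto simp: C2(1))
    have "B \<noteq> C" using C(2) B(1)[of j] j by auto
    then have "B \<inter> C = {}" using partition_onD2[OF part] C(1) less.prems by (auto dest: disjointD)
    then have ne: "Min C \<noteq> ?u" "Max C \<noteq> ?v" "Min C \<noteq> ?v" "Max C \<noteq> ?u" using uv minC maxC by force+
    have "\<not> Min C < ?u"
    proof
      assume "Min C < ?u"
      then have "Max C = j" using C(2) C2(1)[of j] j by auto
      then show False using noncrossingD[OF nc C(1) less.prems minC uv(1) maxC uv(2)]
          \<open>B \<noteq> C\<close> \<open>Min C < ?u\<close> j by auto
    qed
    moreover have "\<not> Max C > ?v"
    proof
      assume "Max C > ?v"
      then have "Min C = j" using C(2) C2(1)[of j] j by auto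
      then show False using noncrossingD[OF nc less.prems C(1) uv(1) minC uv(2) maxC]
          \<open>B \<noteq> C\<close> \<open>Max C > ?v\<close> j by auto
    qed
    ultimately have "Max C - Min C < ?v - ?u" using ne C2(2) by linarith
    then have "k (Min C) = 0 \<and> k (Max C) = 0" using less.hyps C(1) by blast
    then show ?thesis using C(2) C2(1)[of j] by auto
  qed
  have K: "partition_on {1..n} (kreweras n \<sigma>)" "noncrossing (interlace \<sigma> (kreweras n \<sigma>))"
    using kreweras[OF nc] by auto
  have "?u \<in> {1..n}" using partition_onD1[OF part] uv less.prems by blast
  then obtain V where V: "V \<in> kreweras n \<sigma>" "?u \<in> V" using partition_onD1[OF K(1)] by blast
  \<comment> \<open>The chord \<open>B\<close> does not separate points of \<open>V\<close>, and
    \<open>?u\<close> lies in the half-open interval from \<open>?u\<close> to \<open>?v\<close>. In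
    particular \<open>?v\<close> is not in \<open>V\<close>, so the block sum involves only
    \<open>k ?u\<close> and values already known to vanish.\<close>
  have "?u \<le> j \<and> j < ?v" if "j \<in> V" for j
    using noncrossing_interlace_not_crossed[OF K(2) V that] less.prems uv B(2)
    unfolding crossed_def by (metis atLeastLessThan_iff order_refl)
  then have "k j = 0" if "j \<in> V - {?u}" for j using inner[of j] that by force
  moreover have "finite V" using V(1) K(1) by (metis finite_atLeastAtMost finite_subset Union_upper partition_onD1)
  ultimately have "(\<Sum>j\<in>V. k j) = k ?u" using V(2) by (simp add: sum.remove)
  moreover have "(\<Sum>j\<in>V. k j) = 0" using k V(1) by (auto simp: S_def)
  ultimately have "k ?u = 0" by simp
  moreover have "R (k ?u) (k ?v) \<noteq> 0" using nz fin less.prems by auto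
  ultimately show ?case using R[of "k ?v"] by auto
qed

text \<open>For each pairing only the zero vector contributes to the inner sum, and its product is a
  power of \<open>R 0 0 = 1\<close>.\<close>

lemma beta_eq_card_NC2:
  fixes R :: "int \<Rightarrow> int \<Rightarrow> real"
  assumes R: "\<And>k. k \<noteq> 0 \<Longrightarrow> R 0 k = 0" and R0: "R 0 0 = 1"
  shows "beta R n = card (NC2 n)"
proof -
  have "(\<Sum>\<^sub>\<infinity>k\<in>S n \<sigma>. \<Prod>B\<in>\<sigma>. R (k (Min B)) (k (Max B))) = 1" if \<sigma>: "\<sigma> \<in> NC2 n" for \<sigma>
  proof -
    \<comment> \<open>The zero vector of \<open>S n \<sigma>\<close> is 0 on \<open>{1..n}\<close>
      and \<open>undefined\<close> elsewhere, because the members of \<open>S n \<sigma>\<close> are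
      extensional functions.\<close>
    define z :: "nat \<Rightarrow> int" where "z = (\<lambda>j\<in>{1..n}. 0)"
    have part: "partition_on {1..n} \<sigma>" and two: "\<And>B. B \<in> \<sigma> \<Longrightarrow> card B = 2" and nc: "noncrossing \<sigma>"
      using \<sigma> by (auto simp: NC2_def)
    have mem: "Min B \<in> {1..n}" "Max B \<in> {1..n}" if "B \<in> \<sigma>" for B
      using card_2_Min_Max(1)[OF two[OF that]] partition_onD1[OF part] that by blast+
    have "j \<in> {1..n}" if "V \<in> kreweras n \<sigma>" "j \<in> V" for V j
      using partition_onD1[OF kreweras(1)[OF nc]] that by blast
    then have "z j = 0" if "V \<in> kreweras n \<sigma>" "j \<in> V" for V j
      using that unfolding z_def by (meson restrict_apply')
    then have z: "z \<in> S n \<sigma>"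
      unfolding S_def by (intro CollectI conjI ballI sum.neutral) (auto simp: z_def)
    have "k = z" if k: "k \<in> S n \<sigma>" "(\<Prod>B\<in>\<sigma>. R (k (Min B)) (k (Max B))) \<noteq> 0" for k
    proof
      fix j show "k j = z j"
      proof (cases "j \<in> {1..n}")
        case True
        then obtain B where B: "B \<in> \<sigma>" "j \<in> B" using partition_onD1[OF part] by blast
        then have "j = Min B \<or> j = Max B" using card_2_Min_Max(1)[OF two[OF B(1)]] by blast
        then have "k j = 0" using zero_of_nonzero_prod[OF \<sigma> k(1) R k(2) B(1)] by metis
        then show ?thesis using True by (simp add: z_def)
      next
        case False
        have "k \<in> extensional {1..n}" "z \<in> extensional {1..n}"
          using k(1) z by (simp_all add: S_def PiE_def)
        then show ?thesis using False by (metis extensional_arb)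
      qed
    qed
    then have "(\<Prod>B\<in>\<sigma>. R (k (Min B)) (k (Max B))) = 0" if "k \<in> S n \<sigma> - {z}" for k
      using that by blast
    then have "(\<Sum>\<^sub>\<infinity>k\<in>S n \<sigma>. \<Prod>B\<in>\<sigma>. R (k (Min B)) (k (Max B)))
        = (\<Sum>\<^sub>\<infinity>k\<in>{z}. \<Prod>B\<in>\<sigma>. R (k (Min B)) (k (Max B)))"
      by (intro infsum_cong_neutral) (simp_all add: z)
    also have "\<dots> = 1" using mem R0 by (simp add: z_def)
    finally show ?thesis .
  qed
  then show ?thesis by (simp add: beta_def)
qed

text \<open>Both sequences start at 1 and satisfy
  \<open>(n + 4) * c (n + 2) = 4 * (n + 1) * c n\<close>.\<close>

lemma semicircle_even_moment: "(\<integral>x. x ^ (2 * m) \<partial>semicircle) = pairing_count (2 * m)"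
proof (induction m)
  case 0
  then show ?case using semicircle_mass by (simp add: has_bochner_integral_iff pairing_count_0)
next
  case (Suc m)
  have "real (2 * m + 4) * (\<integral>x. x ^ (2 * m + 2) \<partial>semicircle)
      = real (2 * m + 4) * real (pairing_count (2 * m + 2))"
    unfolding semicircle_moment_rec pairing_count_ratio Suc by simp
  then show ?case by simp
qed

text \<open>The ratio of successive terms is \<open>4 * (2 * m + 1) / (2 * m + 4)\<close>, hence at
  most 4. This supplies the growth bound for identifying the law.\<close>

lemma pairing_count_le: "real (pairing_count (2 * m)) \<le> 4 ^ m"
proof (induction m)
  case (Suc m)
  have "real (2 * m + 4) * real (pairing_count (2 * m + 2)) = 4 * real (2 * m + 1) * real (pairing_count (2 * m))"
    by (rule pairing_count_ratio)
  also have "\<dots> \<le> 4 * real (2 * m + 4) * 4 ^ m"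
    using Suc by (intro mult_mono) auto
  finally have "real (2 * m + 4) * real (pairing_count (2 * m + 2)) \<le> real (2 * m + 4) * 4 ^ Suc m"
    by (simp only: power_Suc ac_simps)
  then have "real (pairing_count (2 * m + 2)) \<le> 4 ^ Suc m" by (rule mult_left_le_imp_le) simp
  then show ?case by simp
qed (simp add: pairing_count_0)

section \<open>Determination of a law by its moments\<close>

lemma integrable_power_of_even:
  fixes \<nu> :: "real measure"
  assumes "real_distribution \<nu>" and even: "\<And>m. m \<ge> 1 \<Longrightarrow> integrable \<nu> (\<lambda>x. x ^ (2 * m))"
  shows "integrable \<nu> (\<lambda>x. x ^ n)"
proof -
  interpret real_distribution \<nu> by fact
  \<comment> \<open>With \<open>n + 1\<close> the index is at least 1 even for \<open>n = 0\<close>,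
    and the exponent exceeds \<open>n\<close>, so the even power plus 1 dominates
    \<open>|x| ^ n\<close>.\<close>
  have "integrable \<nu> (\<lambda>x. 1 + x ^ (2 * (n + 1)))" using even[of "n + 1"] by simp
  then show ?thesis
  proof (rule Bochner_Integration.integrable_bound)
    show "AE x in \<nu>. norm (x ^ n) \<le> norm (1 + x ^ (2 * (n + 1)))"
    proof (intro AE_I2)
      fix x :: real
      have "\<bar>x\<bar> ^ n \<le> 1 + \<bar>x\<bar> ^ (2 * (n + 1))"
      proof (cases "\<bar>x\<bar> \<le> 1")
        case True
        then have "\<bar>x\<bar> ^ n \<le> 1" by (simp add: power_le_one)
        then show ?thesis by (simp add: add_increasing2)
      next
        case False
        then have "\<bar>x\<bar> ^ n \<le> \<bar>x\<bar> ^ (2 * (n + 1))" by (intro power_increasing) auto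
        then show ?thesis by simp
      qed
      then show "norm (x ^ n) \<le> norm (1 + x ^ (2 * (n + 1)))"
        by (simp add: power_abs power_mult)
    qed
  qed simp
qed

lemma odd_moment_symmetric:
  fixes \<nu> :: "real measure"
  assumes "real_distribution \<nu>" "distr \<nu> borel uminus = \<nu>" "odd n"
  shows "(\<integral>x. x ^ n \<partial>\<nu>) = 0"
proof -
  interpret real_distribution \<nu> by fact
  have "(\<integral>x. x ^ n \<partial>\<nu>) = (\<integral>x. x ^ n \<partial>distr \<nu> borel uminus)" using assms(2) by simp
  also have "\<dots> = (\<integral>x. (- x) ^ n \<partial>\<nu>)" by (rule integral_distr) auto
  also have "\<dots> = - (\<integral>x. x ^ n \<partial>\<nu>)" using assms(3) by simp
  finally show ?thesis by simp
qed

text \<open>Both characteristic functions are limits of the same Taylor polynomials: the remainder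
  of order \<open>2 * m\<close> is at most \<open>2 * (|t| * c) ^ (2 * m) / fact (2 * m)\<close>.
  Even orders are used because there absolute moments are moments.\<close>

lemma real_distribution_eqI_moments:
  fixes \<mu> \<nu> :: "real measure"
  assumes \<mu>: "real_distribution \<mu>" and \<nu>: "real_distribution \<nu>"
    and int: "\<And>n. integrable \<mu> (\<lambda>x. x ^ n)" "\<And>n. integrable \<nu> (\<lambda>x. x ^ n)"
    and eq: "\<And>n. (\<integral>x. x ^ n \<partial>\<mu>) = (\<integral>x. x ^ n \<partial>\<nu>)"
    and bound: "\<And>m. (\<integral>x. x ^ (2 * m) \<partial>\<nu>) \<le> c ^ (2 * m)"
  shows "\<mu> = \<nu>"
proof (rule Levy_uniqueness[OF \<mu> \<nu>])
  show "char \<mu> = char \<nu>"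
  proof
    fix t :: real
    let ?T = "\<lambda>n. \<Sum>k\<le>n. ((\<i> * t) ^ k / fact k) * complex_of_real (\<integral>x. x ^ k \<partial>\<nu>)"
    have lim: "(\<lambda>m. ?T (2 * m)) \<longlonglongrightarrow> char \<rho> t"
      if "real_distribution \<rho>" "\<And>n. integrable \<rho> (\<lambda>x. x ^ n)"
        "\<And>n. (\<integral>x. x ^ n \<partial>\<rho>) = (\<integral>x. x ^ n \<partial>\<nu>)" for \<rho>
    proof -
      have le: "norm (?T (2 * m) - char \<rho> t) \<le> 2 * ((\<bar>t\<bar> * c) ^ (2 * m) / fact (2 * m))" for m
      proof -
        have "norm (?T (2 * m) - char \<rho> t) \<le> (2 * \<bar>t\<bar> ^ (2 * m) / fact (2 * m)) * (\<integral>x. \<bar>x\<bar> ^ (2 * m) \<partial>\<rho>)"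
          using real_distribution.char_approx1[OF that(1), where n = "2 * m" and t = t] that(2)
          by (simp add: that(3) norm_minus_commute)
        also have "(\<integral>x. \<bar>x\<bar> ^ (2 * m) \<partial>\<rho>) = (\<integral>x. x ^ (2 * m) \<partial>\<nu>)"
          by (simp add: that(3) power_even_abs)
        also have "(2 * \<bar>t\<bar> ^ (2 * m) / fact (2 * m)) * (\<integral>x. x ^ (2 * m) \<partial>\<nu>)
            \<le> (2 * \<bar>t\<bar> ^ (2 * m) / fact (2 * m)) * c ^ (2 * m)"
          by (intro mult_left_mono bound) simp
        finally show ?thesis by (simp add: power_mult_distrib)
      qed
      have "(\<lambda>n. (\<bar>t\<bar> * c) ^ n / fact n) \<longlonglongrightarrow> 0"
        using summable_LIMSEQ_zero[OF summable_exp[of "\<bar>t\<bar> * c"]] by (simp add: field_simps)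
      from LIMSEQ_subseq_LIMSEQ[OF this, of "\<lambda>m. 2 * m"]
      have "(\<lambda>m. (\<bar>t\<bar> * c) ^ (2 * m) / fact (2 * m)) \<longlonglongrightarrow> 0"
        by (simp add: strict_mono_def o_def)
      from tendsto_mult_right_zero[OF this, of 2]
      have "(\<lambda>m. ?T (2 * m) - char \<rho> t) \<longlonglongrightarrow> 0"
        by (rule Lim_null_comparison[rotated]) (intro always_eventually allI le)
      then show ?thesis by (simp add: LIM_zero_iff)
    qed
    show "char \<mu> t = char \<nu> t"
      using LIMSEQ_unique[OF lim[OF \<mu> int(1) eq] lim[OF \<nu> int(2) refl]] .
  qed
qed

theorem theorem7p2:
  fixes M :: "'a measure"
    and Y :: "int \<Rightarrow> int \<Rightarrow> 'a \<Rightarrow> real"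
    and R :: "int \<Rightarrow> int \<Rightarrow> real"
    and \<mu> :: "real measure"
  assumes "stationary_field M Y R"
    and "\<And>u v. R u v = R v u"
    and "(\<lambda>(u, v). \<bar>R u v\<bar>) summable_on UNIV"
    and "limit_law R \<mu>"
    and "\<And>k. k \<noteq> 0 \<Longrightarrow> R k 0 = 0"
  shows "\<mu> = semicircle"
proof -
  interpret stationary_field M Y R by fact
  have "R 0 0 = 1"
    using covariance[of 0 0 0 0] unit_variance[of 0 0] by (simp add: power2_eq_square)
  \<comment> \<open>Symmetry moves the hypothesis to the second argument, where the induction from
    left to right end points uses it.\<close>
  moreover have "R 0 k = 0" if "k \<noteq> 0" for k using assms(2)[of 0 k] assms(5)[OF that] by simp
  ultimately have beta: "beta R n = pairing_count n" for n
    by (simp add: beta_eq_card_NC2 card_NC2)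
  have \<mu>: "real_distribution \<mu>" "distr \<mu> borel uminus = \<mu>"
    and ev: "\<And>m. m \<ge> 1 \<Longrightarrow> has_bochner_integral \<mu> (\<lambda>x. x ^ (2 * m)) (beta R (2 * m))"
    using assms(4) unfolding limit_law_def by blast+
  interpret \<mu>: real_distribution \<mu> by fact
  have "integrable \<mu> (\<lambda>x. x ^ (2 * m))" if "m \<ge> 1" for m
    using ev[OF that] by (simp only: has_bochner_integral_iff)
  then have int: "integrable \<mu> (\<lambda>x. x ^ n)" for n
    by (rule integrable_power_of_even[OF \<mu>(1)])
  \<comment> \<open>The constant \<open>c = 2\<close> is the radius of the support and matches the
    growth rate 4 of the pairing counts.\<close>
  have bound: "(\<integral>x. x ^ (2 * m) \<partial>semicircle) \<le> 2 ^ (2 * m)" for m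
  proof -
    have "(2::real) ^ (2 * m) = 4 ^ m" by (simp add: power_mult)
    then show ?thesis using pairing_count_le[of m] by (simp only: semicircle_even_moment)
  qed
  have even: "(\<integral>x. x ^ (2 * m) \<partial>\<mu>) = (\<integral>x. x ^ (2 * m) \<partial>semicircle)" for m
  proof (cases "m = 0")
    \<comment> \<open>The predicate \<open>limit_law\<close> prescribes moments from
      \<open>m = 1\<close> on; the zeroth moment is the total mass 1 on both sides.\<close>
    case True
    then show ?thesis using semicircle_mass by (simp add: has_bochner_integral_iff \<mu>.prob_space[unfolded \<mu>.space_eq_univ])
  next
    case False
    then have "m \<ge> 1" by simp
    from ev[OF this] show ?thesis
      by (simp only: has_bochner_integral_iff beta semicircle_even_moment)
  qed
  have "(\<integral>x. x ^ n \<partial>\<mu>) = (\<integral>x. x ^ n \<partial>semicircle)" for n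
  proof (cases "even n")
    case True
    then show ?thesis using even by (metis evenE)
  next
    case False
    then show ?thesis
      by (simp only: odd_moment_symmetric[OF \<mu> False]
          odd_moment_symmetric[OF real_distribution_semicircle semicircle_symmetric False])
  qed
  then show ?thesis
    using real_distribution_eqI_moments[OF \<mu>(1) real_distribution_semicircle int
        semicircle_integrable_power _ bound] by blast
qed

end
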